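(* Let $B_1$ and $B_2$ be Bernstein subsets of $\mathbb{R}$ that are subgroups of $(\mathbb{R},+)$, let $\mathcal{B}_j=\mathbb{R}/B_j=\{B_j+x: x\in\mathbb{R}\}$ for $j=1,2$, and let $\mathcal{V}$ be the family of all Vitali selectors of $\mathbb{R}$. Put $\mathcal{T}=\mathcal{S}(\mathcal{B}_1)\vee \mathcal{S}(\mathcal{B}_2)\vee \mathcal{S}(\mathcal{V})$. Then the families $\mathcal{N}_0*\mathcal{T}$ and $\mathcal{T}*\mathcal{N}_0$ are semigroups of sets on $\mathbb{R}$ such that $\mathcal{T}\subseteq \mathcal{N}_0*\mathcal{T}\subseteq \mathcal{T}*\mathcal{N}_0$. Both $\mathcal{N}_0*\mathcal{T}$ and $\mathcal{T}*\mathcal{N}_0$ are invariant under the action of the group $\Phi(\mathbb{R})$ of all translations of $\mathbb{R}$, and they consist of sets which are not Lebesgue measurable.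
   Context: A Bernstein set is a subset $B\subseteq\mathbb{R}$ such that $B\cap F\neq\emptyset$ and $(\mathbb{R}\setminus B)\cap F\neq\emptyset$ for every uncountable closed $F\subseteq\mathbb{R}$. For a countable dense subgroup $Q$ of $(\mathbb{R},+)$, a Vitali selector related to $Q$ is a set $V\subseteq\mathbb{R}$ containing exactly one element of each coset of $Q$; a Vitali selector of $\mathbb{R}$ is a Vitali selector related to some countable dense subgroup $Q$. For a non-empty family $\mathcal{A}$ of sets, $\mathcal{S}(\mathcal{A})=\{\bigcup_{i=1}^n A_i: A_i\in\mathcal{A}, n\in\mathbb{N}\}$ with $n\ge 1$. For families of sets, $\mathcal{A}\vee\mathcal{D}=\{A\cup D: A\in\mathcal{A}, D\in\mathcal{D}\}$ and $\mathcal{A}*\mathcal{D}=\{(A\setminus D_1)\cup D_2: A\in\mathcal{A}, D_1,D_2\in\mathcal{D}\}$. $\mathcal{N}_0$ is the $\sigma$-ideal of Lebesgue null subsets of $\mathbb{R}$. A semigroup of sets is a non-empty family of sets closed under finite unions. A family $\mathcal{O}$ of subsets of $\mathbb{R}$ is invariant under $\Phi(\mathbb{R})$ if $A+t\in\mathcal{O}$ for all $A\in\mathcal{O}$, $t\in\mathbb{R}$. *)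

theory Defs
  imports "HOL-Analysis.Analysis"
begin

definition add_subgroup :: "real set \<Rightarrow> bool" where
  "add_subgroup H \<longleftrightarrow>
     0 \<in> H \<and> (\<forall>x\<in>H. \<forall>y\<in>H. x + y \<in> H) \<and> (\<forall>x\<in>H. - x \<in> H)"

definition add_cosets :: "real set \<Rightarrow> real set set" where
  "add_cosets H = {(\<lambda>h. h + x) ` H | x. True}"

definition bernstein_set :: "real set \<Rightarrow> bool" where
  "bernstein_set B \<longleftrightarrow>
     (\<forall>F. closed F \<and> uncountable F \<longrightarrow> B \<inter> F \<noteq> {} \<and> (UNIV - B) \<inter> F \<noteq> {})"

definition countable_dense_subgroup :: "real set \<Rightarrow> bool" where
  "countable_dense_subgroup Q \<longleftrightarrow> add_subgroup Q \<and> countable Q \<and> closure Q = UNIV"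

definition vitali_selector_of :: "real set \<Rightarrow> real set \<Rightarrow> bool" where
  "vitali_selector_of Q V \<longleftrightarrow> (\<forall>C\<in>add_cosets Q. \<exists>!v. v \<in> V \<inter> C)"

text \<open>The group \<open>Q\<close> may vary from one selector to another.\<close>

definition vitali_selectors :: "real set set" where
  "vitali_selectors = {V. \<exists>Q. countable_dense_subgroup Q \<and> vitali_selector_of Q V}"

definition fin_unions :: "'a set set \<Rightarrow> 'a set set" where
  "fin_unions \<A> =
     {\<Union>i\<in>{1..n}. A i | (A :: nat \<Rightarrow> 'a set) n. n \<ge> 1 \<and> (\<forall>i\<in>{1..n}. A i \<in> \<A>)}"

definition fam_join :: "'a set set \<Rightarrow> 'a set set \<Rightarrow> 'a set set"  (infixl "\<or>\<^sub>F" 65) where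
  "\<A> \<or>\<^sub>F \<D> = {A \<union> D | A D. A \<in> \<A> \<and> D \<in> \<D>}"

definition fam_star :: "'a set set \<Rightarrow> 'a set set \<Rightarrow> 'a set set"  (infixl "*\<^sub>F" 70) where
  "\<A> *\<^sub>F \<D> = {(A - D1) \<union> D2 | A D1 D2. A \<in> \<A> \<and> D1 \<in> \<D> \<and> D2 \<in> \<D>}"

text \<open>Only unions of at least one set are considered, so the empty set need not belong to a
  semigroup of sets.\<close>

definition semigroup_of_sets :: "'a set set \<Rightarrow> bool" where
  "semigroup_of_sets \<A> \<longleftrightarrow>
     \<A> \<noteq> {} \<and> (\<forall>\<F>. finite \<F> \<and> \<F> \<noteq> {} \<and> \<F> \<subseteq> \<A> \<longrightarrow> \<Union>\<F> \<in> \<A>)"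

definition translation_invariant :: "real set set \<Rightarrow> bool" where
  "translation_invariant \<O> \<longleftrightarrow> (\<forall>A\<in>\<O>. \<forall>t. (\<lambda>a. a + t) ` A \<in> \<O>)"

abbreviation lebesgue_null :: "real set set" where
  "lebesgue_null \<equiv> null_sets lebesgue"

end

theory Submission
  imports Defs
begin

text \<open>
  Up to null sets, the members of both families are members of \<open>\<T>\<close>, so it suffices to see that
  \<open>U \<in> \<T>\<close> is not Lebesgue measurable. Since \<open>U\<close> contains a coset of \<open>B1\<close>, no uncountable closed set
  avoids \<open>U\<close>, so a measurable \<open>U\<close> would be conull. On the other hand, each coset of \<open>B1\<close> or \<open>B2\<close> and
  each Vitali selector can be hit by at most one element of every translate of a suitable finite
  set of any prescribed size (for \<open>Bj\<close> because a proper subgroup of the divisible group of the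
  reals has infinite index). Sumsets of such finite sets show that every translate of some finite
  set \<open>G\<close> leaves \<open>U\<close>. Hence finitely many translates of the complement of \<open>U\<close> cover the line, so this
  complement is not null.
\<close>

section \<open>Sets that are sparse along translations\<close>

text \<open>The displacements form a list because sums of displacements may coincide and have to be
  counted with multiplicity.\<close>

definition translation_sparse :: "real set \<Rightarrow> bool" where
  "translation_sparse S \<longleftrightarrow>
     (\<forall>k::nat. \<exists>ds. ds \<noteq> [] \<and> (\<forall>x. k * length (filter (\<lambda>d. x + d \<in> S) ds) \<le> length ds))"

lemma length_filter_disj_le:
  "length (filter (\<lambda>x. P x \<or> Q x) xs) \<le> length (filter P xs) + length (filter Q xs)"
  by (induction xs) auto

lemma length_filter_product:
  "length (filter P (List.product xs ys)) = (\<Sum>x\<leftarrow>xs. length (filter (\<lambda>y. P (x, y)) ys))"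
  by (induction xs) (auto simp: filter_map comp_def)

text \<open>The product is counted by columns instead of rows, so that each of the two components of
  a pair can be held fixed in turn.\<close>

lemma length_filter_product_swap:
  "length (filter P (List.product xs ys)) = (\<Sum>y\<leftarrow>ys. length (filter (\<lambda>x. P (x, y)) xs))"
proof (induction xs)
  case (Cons x xs)
  have "length (filter (\<lambda>y. P (x, y)) ys) + (\<Sum>y\<leftarrow>ys. length (filter (\<lambda>x. P (x, y)) xs)) =
      (\<Sum>y\<leftarrow>ys. length (filter (\<lambda>x. P (x, y)) (x # xs)))"
    by (induction ys) auto
  then show ?case
    using Cons by (simp add: filter_map comp_def)
qed simp

text \<open>All sums of a displacement for \<open>S\<close> and one for \<open>R\<close> serve both
  sets at once. Asking for proportion \<open>1 / (2 * k)\<close> of hits in each set leaves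
  \<open>1 / k\<close> for the union.\<close>

lemma translation_sparse_Un:
  assumes "translation_sparse S" "translation_sparse R"
  shows "translation_sparse (S \<union> R)"
  unfolding translation_sparse_def
proof
  fix k :: nat
  obtain ds where ds: "ds \<noteq> []" "\<And>x. 2 * k * length (filter (\<lambda>d. x + d \<in> S) ds) \<le> length ds"
    using assms(1) unfolding translation_sparse_def by blast
  obtain es where es: "es \<noteq> []" "\<And>x. 2 * k * length (filter (\<lambda>d. x + d \<in> R) es) \<le> length es"
    using assms(2) unfolding translation_sparse_def by blast
  define fs where "fs = map (\<lambda>(d, e). d + e) (List.product ds es)"
  have "k * length (filter (\<lambda>d. x + d \<in> S \<union> R) fs) \<le> length fs" for x
  proof -
    let ?s = "length (filter (\<lambda>(d, e). x + (d + e) \<in> S) (List.product ds es))"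
    let ?r = "length (filter (\<lambda>(d, e). x + (d + e) \<in> R) (List.product ds es))"
    \<comment> \<open>For fixed \<open>e\<close> the list \<open>ds\<close> is tested from the base
      point \<open>x + e\<close>. This is where the uniformity in the base point is needed.\<close>
    have "2 * k * ?s = (\<Sum>e\<leftarrow>es. 2 * k * length (filter (\<lambda>d. (x + e) + d \<in> S) ds))"
      by (simp add: length_filter_product_swap sum_list_const_mult ac_simps)
    also have "\<dots> \<le> (\<Sum>e\<leftarrow>es. length ds)"
      by (intro sum_list_mono ds(2))
    finally have s: "2 * k * ?s \<le> length ds * length es"
      by (simp add: sum_list_triv mult.commute)
    have "2 * k * ?r = (\<Sum>d\<leftarrow>ds. 2 * k * length (filter (\<lambda>e. (x + d) + e \<in> R) es))"
      by (simp add: length_filter_product sum_list_const_mult ac_simps)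
    also have "\<dots> \<le> (\<Sum>d\<leftarrow>ds. length es)"
      by (intro sum_list_mono es(2))
    finally have r: "2 * k * ?r \<le> length ds * length es"
      by (simp add: sum_list_triv)
    have "length (filter (\<lambda>d. x + d \<in> S \<union> R) fs) \<le> ?s + ?r"
      using length_filter_disj_le [of "\<lambda>(d, e). x + (d + e) \<in> S" "\<lambda>(d, e). x + (d + e) \<in> R" "List.product ds es"]
      by (simp add: fs_def filter_map comp_def case_prod_unfold)
    then have "k * length (filter (\<lambda>d. x + d \<in> S \<union> R) fs) \<le> k * (?s + ?r)"
      by simp
    also have "\<dots> \<le> length ds * length es"
      using s r by (simp add: algebra_simps)
    finally show ?thesis
      by (simp add: fs_def)
  qed
  moreover have "fs \<noteq> []"
    using ds(1) es(1) by (cases ds; cases es) (simp_all add: fs_def)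
  ultimately show "\<exists>ds. ds \<noteq> [] \<and> (\<forall>x. k * length (filter (\<lambda>d. x + d \<in> S \<union> R) ds) \<le> length ds)"
    by (intro exI [of _ fs] conjI allI)
qed

lemma translation_sparse_Union:
  assumes "finite \<F>" "\<And>S. S \<in> \<F> \<Longrightarrow> translation_sparse S"
  shows "translation_sparse (\<Union>\<F>)"
  using assms
proof (induction \<F>)
  case empty
  have "translation_sparse {}"
    unfolding translation_sparse_def by (intro allI exI [of _ "[0]"]) simp
  then show ?case by simp
next
  case (insert S \<F>)
  then show ?case by (simp add: translation_sparse_Un)
qed

text \<open>Cosets and selectors satisfy this stronger condition, but it need not pass to unions:
  the differences between points of two such sets may exhaust the reals. Counting proportions of
  hits avoids this obstacle.\<close>

lemma translation_sparseI:
  assumes "\<And>n. \<exists>D. finite D \<and> card D = Suc n \<and>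
    (\<forall>x. \<forall>d\<in>D. \<forall>e\<in>D. x + d \<in> S \<longrightarrow> x + e \<in> S \<longrightarrow> d = e)"
  shows "translation_sparse S"
  unfolding translation_sparse_def
proof
  fix k :: nat
  \<comment> \<open>One displacement more than the bound asks for, so that \<open>ds\<close> is
    non-empty even for \<open>k = 0\<close>.\<close>
  obtain D where D: "finite D" "card D = Suc k"
    "\<And>x d e. d \<in> D \<Longrightarrow> e \<in> D \<Longrightarrow> x + d \<in> S \<Longrightarrow> x + e \<in> S \<Longrightarrow> d = e"
    using assms [of k] by blast
  obtain ds where ds: "set ds = D" "distinct ds"
    using finite_distinct_list [OF D(1)] by blast
  have len: "length ds = Suc k"
    using ds D(2) distinct_card by metis
  have "length (filter (\<lambda>d. x + d \<in> S) ds) \<le> 1" for x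
  proof -
    have "card {d \<in> D. x + d \<in> S} \<le> Suc 0"
      using D by (subst card_le_Suc0_iff_eq) auto
    moreover have "length (filter (\<lambda>d. x + d \<in> S) ds) = card {d \<in> D. x + d \<in> S}"
      using ds by (metis distinct_card distinct_filter set_filter)
    ultimately show ?thesis by simp
  qed
  then have "k * length (filter (\<lambda>d. x + d \<in> S) ds) \<le> k * 1" for x
    using mult_le_mono2 by blast
  then have "k * length (filter (\<lambda>d. x + d \<in> S) ds) \<le> length ds" for x
    by (metis len le_SucI mult.right_neutral)
  moreover have "ds \<noteq> []"
    using len by auto
  ultimately show "\<exists>ds. ds \<noteq> [] \<and> (\<forall>x. k * length (filter (\<lambda>d. x + d \<in> S) ds) \<le> length ds)"
    by blast
qed

section \<open>Null sets and complements of sparse sets\<close>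

lemma null_sets_lebesgue_translation:
  fixes N :: "real set"
  assumes "N \<in> null_sets lebesgue"
  shows "(\<lambda>a. a + t) ` N \<in> null_sets lebesgue"
proof -
  have "(\<lambda>a. a + t) ` N = (+) t ` N"
    by (rule image_cong [OF refl]) (rule add.commute)
  then show ?thesis
    using negligible_translation [of N t] assms unfolding negligible_iff_null_sets by metis
qed

lemma translation_sparse_compl_not_null:
  assumes "translation_sparse S"
  shows "- S \<notin> null_sets lebesgue"
proof
  assume null: "- S \<in> null_sets lebesgue"
  \<comment> \<open>The value \<open>k = 2\<close> lets at most half of the displacements hit
    \<open>S\<close>, so at least one of them escapes; \<open>k = 1\<close> would allow all of them
    to hit.\<close>
  obtain ds where ds: "ds \<noteq> []" "\<And>x. 2 * length (filter (\<lambda>d. x + d \<in> S) ds) \<le> length ds"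
    using assms unfolding translation_sparse_def by blast
  have escape: "\<exists>d\<in>set ds. x + d \<notin> S" for x
  proof (rule ccontr)
    assume "\<not> (\<exists>d\<in>set ds. x + d \<notin> S)"
    then have "filter (\<lambda>d. x + d \<in> S) ds = ds"
      by simp
    then show False
      using ds(1) ds(2) [of x] by simp
  qed
  have "x \<in> (\<Union>d\<in>set ds. (\<lambda>a. a + - d) ` (- S))" for x
  proof -
    obtain d where "d \<in> set ds" "x + d \<notin> S"
      using escape by blast
    moreover from this have "x \<in> (\<lambda>a. a + - d) ` (- S)"
      by (intro image_eqI [of _ _ "x + d"]) simp_all
    ultimately show ?thesis by blast
  qed
  then have "(UNIV :: real set) = (\<Union>d\<in>set ds. (\<lambda>a. a + - d) ` (- S))"
    by blast
  moreover have "(\<Union>d\<in>set ds. (\<lambda>a. a + - d) ` (- S)) \<in> null_sets lebesgue"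
    by (intro null_sets.finite_UN null_sets_lebesgue_translation null) auto
  ultimately have "emeasure lebesgue (UNIV :: real set) = 0"
    by (metis null_setsD1)
  then show False
    by simp
qed

section \<open>Cosets and Vitali selectors\<close>

lemma add_subgroup_diff:
  assumes "add_subgroup H" "x \<in> H" "y \<in> H"
  shows "x - y \<in> H"
proof -
  have "x + - y \<in> H"
    using assms unfolding add_subgroup_def by blast
  then show ?thesis by simp
qed

lemma add_subgroup_of_nat_mult:
  assumes "add_subgroup H" "x \<in> H"
  shows "real n * x \<in> H"
proof (induction n)
  case 0
  then show ?case
    using assms(1) by (simp add: add_subgroup_def)
next
  case (Suc n)
  then have "x + real n * x \<in> H"
    using assms unfolding add_subgroup_def by blast
  then show ?case
    by (simp add: distrib_right)
qed

lemma mem_add_coset_iff: "y \<in> (\<lambda>h. h + x) ` H \<longleftrightarrow> y - x \<in> (H :: real set)"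
  by (force simp: image_iff)

lemma add_coset_diff:
  assumes "add_subgroup H" "C \<in> add_cosets H" "x \<in> C" "y \<in> C"
  shows "x - y \<in> H"
proof -
  obtain z where "C = (\<lambda>h. h + z) ` H"
    using assms(2) unfolding add_cosets_def by blast
  then show ?thesis
    using add_subgroup_diff [OF assms(1), of "x - z" "y - z"] assms(3,4)
    by (simp add: mem_add_coset_iff)
qed

lemma add_cosets_translate:
  assumes "C \<in> add_cosets H"
  shows "(\<lambda>a. a + t) ` C \<in> add_cosets H"
proof -
  obtain z where "C = (\<lambda>h. h + z) ` H"
    using assms unfolding add_cosets_def by blast
  then have "(\<lambda>a. a + t) ` C = (\<lambda>h. h + (z + t)) ` H"
    by (simp add: image_image add.assoc)
  then show ?thesis
    unfolding add_cosets_def by blast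
qed

text \<open>For \<open>c\<close> outside \<open>H\<close>, the multiples of
  \<open>c / fact n\<close> by \<open>0, ..., n\<close> lie in pairwise different cosets of
  \<open>H\<close>. Hence no translate of them has two points in \<open>C\<close>.\<close>

lemma translation_sparse_add_coset:
  assumes "add_subgroup H" "H \<noteq> UNIV" "C \<in> add_cosets H"
  shows "translation_sparse C"
proof (rule translation_sparseI)
  fix n :: nat
  obtain c where c: "c \<notin> H"
    using assms(2) by blast
  have "0 \<in> H"
    using assms(1) unfolding add_subgroup_def by blast
  then have c0: "c \<noteq> 0"
    using c by auto
  define d where "d i = real i * (c / fact n)" for i :: nat
  text \<open>A positive difference of indices divides \<open>n!\<close>, so that \<open>c\<close> is a multiple of the
    corresponding difference of displacements.\<close>
  have sep: "d j - d i \<notin> H" if "i < j" "j \<le> n" for i j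
  proof
    assume "d j - d i \<in> H"
    have "j - i dvd fact n"
      using that by (intro dvd_fact) auto
    then obtain m where m: "fact n = (j - i) * m"
      by blast
    have "(fact n :: real) = real (fact n)"
      by simp
    also have "\<dots> = (real j - real i) * real m"
      using m that by (simp add: of_nat_diff)
    finally have m': "(fact n :: real) = (real j - real i) * real m" .
    have "real m * (d j - d i) = ((real j - real i) * real m) * (c / fact n)"
      by (simp add: d_def algebra_simps diff_divide_distrib)
    also have "\<dots> = c"
      using m' by (metis fact_nonzero nonzero_mult_div_cancel_left times_divide_eq_right)
    finally show False
      using add_subgroup_of_nat_mult [OF assms(1) \<open>d j - d i \<in> H\<close>, of m] c by simp
  qed
  have "i = j" if "i \<le> n" "j \<le> n" "x + d i \<in> C" "x + d j \<in> C" for x i j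
  proof -
    have "d j - d i \<in> H" "d i - d j \<in> H"
      using add_coset_diff [OF assms(1,3) that(4,3)] add_coset_diff [OF assms(1,3) that(3,4)]
      by simp_all
    then show ?thesis
      using sep that(1,2) by (meson nat_neq_iff)
  qed
  then have "\<forall>x. \<forall>a\<in>d ` {..n}. \<forall>b\<in>d ` {..n}. x + a \<in> C \<longrightarrow> x + b \<in> C \<longrightarrow> a = b"
    by auto
  moreover have "inj_on d {..n}"
    using c0 by (auto simp: inj_on_def d_def)
  then have "card (d ` {..n}) = Suc n"
    by (simp add: card_image)
  ultimately show "\<exists>D. finite D \<and> card D = Suc n \<and>
      (\<forall>x. \<forall>a\<in>D. \<forall>b\<in>D. x + a \<in> C \<longrightarrow> x + b \<in> C \<longrightarrow> a = b)"
    by blast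
qed

section \<open>Vitali selectors\<close>

lemma countable_dense_subgroup_infinite:
  assumes "countable_dense_subgroup Q"
  shows "infinite Q"
proof
  assume "finite Q"
  then have "closure Q = Q"
    by (simp add: finite_imp_closed)
  then show False
    using assms \<open>finite Q\<close> infinite_UNIV_char_0 unfolding countable_dense_subgroup_def by metis
qed

lemma vitali_selector_of_iff:
  "vitali_selector_of Q V \<longleftrightarrow> (\<forall>x. \<exists>!v. v \<in> V \<and> v - x \<in> Q)"
proof -
  have "add_cosets Q = range (\<lambda>x. (\<lambda>h. h + x) ` Q)"
    unfolding add_cosets_def by blast
  then show ?thesis
    unfolding vitali_selector_of_def by (simp add: mem_add_coset_iff)
qed

text \<open>Displacements taken from \<open>Q\<close> stay in the coset of \<open>x\<close>, where
  \<open>V\<close> has only one point. Being infinite, \<open>Q\<close> supplies as many of them as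
  required.\<close>

lemma translation_sparse_vitali_selector:
  assumes "V \<in> vitali_selectors"
  shows "translation_sparse V"
proof (rule translation_sparseI)
  fix n :: nat
  obtain Q where Q: "countable_dense_subgroup Q" "vitali_selector_of Q V"
    using assms unfolding vitali_selectors_def by blast
  obtain D where D: "finite D" "card D = Suc n" "D \<subseteq> Q"
    using infinite_arbitrarily_large [OF countable_dense_subgroup_infinite [OF Q(1)]] by blast
  have "d = e" if "d \<in> D" "e \<in> D" "x + d \<in> V" "x + e \<in> V" for x d e
  proof -
    have "x + d \<in> V \<and> x + d - x \<in> Q" "x + e \<in> V \<and> x + e - x \<in> Q"
      using that D(3) by auto
    then have "x + d = x + e"
      using Q(2) unfolding vitali_selector_of_iff by blast
    then show ?thesis by simp
  qed
  then show "\<exists>D. finite D \<and> card D = Suc n \<and>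
      (\<forall>x. \<forall>d\<in>D. \<forall>e\<in>D. x + d \<in> V \<longrightarrow> x + e \<in> V \<longrightarrow> d = e)"
    using D by blast
qed

text \<open>The same group \<open>Q\<close> works: the representative of the coset of
  \<open>x - t\<close> moves to a representative of the coset of \<open>x\<close>.\<close>

lemma vitali_selectors_translate:
  assumes "V \<in> vitali_selectors"
  shows "(\<lambda>a. a + t) ` V \<in> vitali_selectors"
proof -
  obtain Q where Q: "countable_dense_subgroup Q" "vitali_selector_of Q V"
    using assms unfolding vitali_selectors_def by blast
  have "\<exists>!v. v \<in> (\<lambda>a. a + t) ` V \<and> v - x \<in> Q" for x
  proof -
    have "\<exists>!v. v \<in> V \<and> v - (x - t) \<in> Q"
      using Q(2) unfolding vitali_selector_of_iff by blast
    then obtain v where v: "v \<in> V" "v - (x - t) \<in> Q" "\<And>w. w \<in> V \<Longrightarrow> w - (x - t) \<in> Q \<Longrightarrow> w = v"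
      by blast
    show ?thesis
    proof (rule ex1I [of _ "v + t"])
      show "v + t \<in> (\<lambda>a. a + t) ` V \<and> v + t - x \<in> Q"
        using v(1,2) by (simp add: algebra_simps)
    next
      fix w
      assume w: "w \<in> (\<lambda>a. a + t) ` V \<and> w - x \<in> Q"
      then have "w - t = v"
        by (intro v(3)) (auto simp: algebra_simps)
      then show "w = v + t" by simp
    qed
  qed
  then show ?thesis
    using Q(1) unfolding vitali_selectors_def vitali_selector_of_iff by blast
qed

lemma countable_dense_subgroup_Rats: "countable_dense_subgroup \<rat>"
proof -
  have "closure (\<rat> :: real set) = UNIV"
    by (rule Rats_closure_real)
  then show ?thesis
    unfolding countable_dense_subgroup_def add_subgroup_def by (simp add: countable_rat)
qed

lemma vitali_selectors_nonempty: "vitali_selectors \<noteq> {}"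
proof -
  \<comment> \<open>The choice depends on \<open>x\<close> only through the predicate defining its
    rational coset, so \<open>f\<close> is constant on cosets and its range is a selector.\<close>
  define f where "f x = (SOME v. v - x \<in> \<rat>)" for x :: real
  have f: "f x - x \<in> \<rat>" for x
    unfolding f_def by (rule someI [of _ x]) simp
  have f_eq: "f x = f y" if "x - y \<in> \<rat>" for x y
  proof -
    have "v - x \<in> \<rat> \<longleftrightarrow> v - y \<in> \<rat>" for v
      using that Rats_add [of "v - x" "x - y"] Rats_diff [of "v - y" "x - y"] by auto
    then show ?thesis
      by (simp add: f_def)
  qed
  have "\<exists>!v. v \<in> range f \<and> v - x \<in> \<rat>" for x
  proof (rule ex1I [of _ "f x"])
    show "f x \<in> range f \<and> f x - x \<in> \<rat>"
      using f by simp
  next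
    fix v
    assume v: "v \<in> range f \<and> v - x \<in> \<rat>"
    then obtain y where y: "v = f y" by blast
    have "y - x \<in> \<rat>"
      using Rats_diff [of "v - x" "f y - y"] v f [of y] y by simp
    then show "v = f x"
      using f_eq y by simp
  qed
  then have "range f \<in> vitali_selectors"
    using countable_dense_subgroup_Rats
    unfolding vitali_selectors_def vitali_selector_of_iff by blast
  then show ?thesis by blast
qed

section \<open>Semigroups of sets\<close>

text \<open>Trades indexed unions for finite non-empty subfamilies, which can be merged or
  translated without renumbering.\<close>

lemma fin_unions_eq: "fin_unions \<A> = {\<Union>\<F> | \<F>. finite \<F> \<and> \<F> \<noteq> {} \<and> \<F> \<subseteq> \<A>}"
proof (intro equalityI subsetI)
  fix X
  assume "X \<in> fin_unions \<A>"
  then obtain A and n :: nat where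
    "X = (\<Union>i\<in>{1..n}. A i)" "n \<ge> 1" "\<forall>i\<in>{1..n}. A i \<in> \<A>"
    unfolding fin_unions_def by blast
  then show "X \<in> {\<Union>\<F> | \<F>. finite \<F> \<and> \<F> \<noteq> {} \<and> \<F> \<subseteq> \<A>}"
    by (intro CollectI exI [of _ "A ` {1..n}"]) auto
next
  fix X
  assume "X \<in> {\<Union>\<F> | \<F>. finite \<F> \<and> \<F> \<noteq> {} \<and> \<F> \<subseteq> \<A>}"
  then obtain \<F> where \<F>: "X = \<Union>\<F>" "finite \<F>" "\<F> \<noteq> {}" "\<F> \<subseteq> \<A>"
    by blast
  obtain h where h: "bij_betw h {1..card \<F>} \<F>"
    using ex_bij_betw_nat_finite_1 [OF \<F>(2)] by blast
  then have im: "h ` {1..card \<F>} = \<F>"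
    by (simp add: bij_betw_def)
  have "card \<F> \<ge> 1"
    using \<F>(2,3) by (simp add: Suc_le_eq card_gt_0_iff)
  moreover have "\<forall>i\<in>{1..card \<F>}. h i \<in> \<A>"
    using im \<F>(4) by blast
  moreover have "X = (\<Union>i\<in>{1..card \<F>}. h i)"
    using \<F>(1) im by simp
  ultimately show "X \<in> fin_unions \<A>"
    unfolding fin_unions_def by blast
qed

lemma translation_sparse_fin_unions:
  assumes "X \<in> fin_unions \<A>" "\<And>A. A \<in> \<A> \<Longrightarrow> translation_sparse A"
  shows "translation_sparse X"
proof -
  obtain \<F> where \<F>: "X = \<Union>\<F>" "finite \<F>" "\<F> \<subseteq> \<A>"
    using assms(1) unfolding fin_unions_eq by blast
  show ?thesis
    unfolding \<F>(1) using \<F>(2,3) assms(2) by (intro translation_sparse_Union) blast+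
qed

lemma semigroup_of_setsI:
  assumes "\<A> \<noteq> {}" "\<And>A B. A \<in> \<A> \<Longrightarrow> B \<in> \<A> \<Longrightarrow> A \<union> B \<in> \<A>"
  shows "semigroup_of_sets \<A>"
proof -
  have "\<Union>\<F> \<in> \<A>" if "finite \<F>" "\<F> \<noteq> {}" "\<F> \<subseteq> \<A>" for \<F>
    using that by (induction \<F> rule: finite_ne_induct) (auto intro: assms(2))
  then show ?thesis
    using assms(1) unfolding semigroup_of_sets_def by blast
qed

lemma semigroup_of_sets_Un:
  assumes "semigroup_of_sets \<A>" "A \<in> \<A>" "B \<in> \<A>"
  shows "A \<union> B \<in> \<A>"
proof -
  have "finite {A, B} \<and> {A, B} \<noteq> {} \<and> {A, B} \<subseteq> \<A>"
    using assms(2,3) by simp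
  then have "\<Union>{A, B} \<in> \<A>"
    using assms(1) unfolding semigroup_of_sets_def by blast
  then show ?thesis by simp
qed

lemma semigroup_fin_unions:
  assumes "\<A> \<noteq> {}"
  shows "semigroup_of_sets (fin_unions \<A>)"
proof (rule semigroup_of_setsI)
  obtain A where "A \<in> \<A>"
    using assms by blast
  then have "\<Union>{A} \<in> fin_unions \<A>"
    unfolding fin_unions_eq by blast
  then show "fin_unions \<A> \<noteq> {}" by blast
next
  fix A B
  assume "A \<in> fin_unions \<A>" "B \<in> fin_unions \<A>"
  then obtain \<F> \<G> where "A = \<Union>\<F>" "finite \<F>" "\<F> \<noteq> {}" "\<F> \<subseteq> \<A>"
    "B = \<Union>\<G>" "finite \<G>" "\<G> \<noteq> {}" "\<G> \<subseteq> \<A>"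
    unfolding fin_unions_eq by blast
  then show "A \<union> B \<in> fin_unions \<A>"
    unfolding fin_unions_eq by (intro CollectI exI [of _ "\<F> \<union> \<G>"]) auto
qed

lemma semigroup_fam_join:
  assumes "semigroup_of_sets \<A>" "semigroup_of_sets \<D>"
  shows "semigroup_of_sets (\<A> \<or>\<^sub>F \<D>)"
proof (rule semigroup_of_setsI)
  show "\<A> \<or>\<^sub>F \<D> \<noteq> {}"
    using assms unfolding semigroup_of_sets_def fam_join_def by blast
next
  fix X Y
  assume "X \<in> \<A> \<or>\<^sub>F \<D>" "Y \<in> \<A> \<or>\<^sub>F \<D>"
  then obtain A D A' D' where "X = A \<union> D" "A \<in> \<A>" "D \<in> \<D>" "Y = A' \<union> D'" "A' \<in> \<A>" "D' \<in> \<D>"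
    unfolding fam_join_def by blast
  moreover from this have "A \<union> A' \<in> \<A>" "D \<union> D' \<in> \<D>"
    using assms semigroup_of_sets_Un by blast+
  ultimately show "X \<union> Y \<in> \<A> \<or>\<^sub>F \<D>"
    unfolding fam_join_def by (intro CollectI exI [of _ "A \<union> A'"] exI [of _ "D \<union> D'"]) auto
qed

lemma translation_invariant_fin_unions:
  assumes "translation_invariant \<A>"
  shows "translation_invariant (fin_unions \<A>)"
  unfolding translation_invariant_def
proof (intro ballI allI)
  fix A t
  assume "A \<in> fin_unions \<A>"
  then obtain \<F> where \<F>: "A = \<Union>\<F>" "finite \<F>" "\<F> \<noteq> {}" "\<F> \<subseteq> \<A>"
    unfolding fin_unions_eq by blast
  then show "(\<lambda>a. a + t) ` A \<in> fin_unions \<A>"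
    using assms unfolding fin_unions_eq translation_invariant_def
    by (intro CollectI exI [of _ "(\<lambda>S. (\<lambda>a. a + t) ` S) ` \<F>"]) auto
qed

lemma translation_invariant_fam_join:
  assumes "translation_invariant \<A>" "translation_invariant \<D>"
  shows "translation_invariant (\<A> \<or>\<^sub>F \<D>)"
  unfolding translation_invariant_def
proof (intro ballI allI)
  fix X and t :: real
  assume "X \<in> \<A> \<or>\<^sub>F \<D>"
  then obtain A D where *: "X = A \<union> D" "A \<in> \<A>" "D \<in> \<D>"
    unfolding fam_join_def by blast
  have "(\<lambda>a. a + t) ` X = (\<lambda>a. a + t) ` A \<union> (\<lambda>a. a + t) ` D"
    unfolding *(1) by (rule image_Un)
  moreover have "(\<lambda>a. a + t) ` A \<in> \<A>" "(\<lambda>a. a + t) ` D \<in> \<D>"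
    using * assms unfolding translation_invariant_def by blast+
  ultimately show "(\<lambda>a. a + t) ` X \<in> \<A> \<or>\<^sub>F \<D>"
    unfolding fam_join_def by blast
qed

lemma translation_invariant_fam_star:
  assumes "translation_invariant \<A>" "translation_invariant \<D>"
  shows "translation_invariant (\<A> *\<^sub>F \<D>)"
  unfolding translation_invariant_def
proof (intro ballI allI)
  fix X and t :: real
  assume "X \<in> \<A> *\<^sub>F \<D>"
  then obtain A D1 D2 where *: "X = (A - D1) \<union> D2" "A \<in> \<A>" "D1 \<in> \<D>" "D2 \<in> \<D>"
    unfolding fam_star_def by blast
  let ?f = "\<lambda>a. a + t"
  have "?f ` X = (?f ` A - ?f ` D1) \<union> ?f ` D2"
    unfolding *(1) image_Un by (subst image_set_diff) (auto simp: inj_on_def)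
  moreover have "?f ` A \<in> \<A>" "?f ` D1 \<in> \<D>" "?f ` D2 \<in> \<D>"
    using * assms unfolding translation_invariant_def by blast+
  ultimately show "?f ` X \<in> \<A> *\<^sub>F \<D>"
    unfolding fam_star_def by blast
qed

section \<open>Families modified by null sets\<close>

lemma translation_invariant_null_sets: "translation_invariant lebesgue_null"
  unfolding translation_invariant_def by (blast intro: null_sets_lebesgue_translation)

text \<open>Subsets of null sets are null, so removing a member of \<open>\<T>\<close> from a null
  set only gives another null set.\<close>

lemma null_fam_star_eq: "lebesgue_null *\<^sub>F \<T> = {N \<union> U | N U. N \<in> lebesgue_null \<and> U \<in> \<T>}"
proof (intro equalityI subsetI)
  fix X
  assume "X \<in> lebesgue_null *\<^sub>F \<T>"
  then obtain N T U where *: "X = (N - T) \<union> U" "N \<in> lebesgue_null" "U \<in> \<T>"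
    unfolding fam_star_def by blast
  have "N - T \<in> lebesgue_null"
    using * by (meson Diff_subset completion.complete2 null_sets_completion_subset)
  then show "X \<in> {N \<union> U | N U. N \<in> lebesgue_null \<and> U \<in> \<T>}"
    using * by blast
next
  fix X
  assume "X \<in> {N \<union> U | N U. N \<in> lebesgue_null \<and> U \<in> \<T>}"
  then obtain N U where *: "X = N \<union> U" "N \<in> lebesgue_null" "U \<in> \<T>"
    by blast
  \<comment> \<open>The removed set must itself lie in \<open>\<T>\<close>; taking \<open>U\<close>
    for it is harmless because \<open>U\<close> is added back.\<close>
  then have "X = (N - U) \<union> U"
    by blast
  then show "X \<in> lebesgue_null *\<^sub>F \<T>"
    using * unfolding fam_star_def by blast
qed

text \<open>Identifies the family with the sets that agree with a member of \<open>\<T>\<close> up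
  to a null set. The exact differences \<open>U - X\<close> and \<open>X - U\<close> are the
  required null sets.\<close>

lemma fam_star_null_eq: "\<T> *\<^sub>F lebesgue_null = {X. \<exists>U\<in>\<T>. sym_diff U X \<in> lebesgue_null}"
proof (intro equalityI subsetI)
  fix X
  assume "X \<in> \<T> *\<^sub>F lebesgue_null"
  then obtain U M N where *: "X = (U - M) \<union> N" "U \<in> \<T>" "M \<in> lebesgue_null" "N \<in> lebesgue_null"
    unfolding fam_star_def by blast
  have "sym_diff U X \<subseteq> M \<union> N"
    using *(1) by blast
  then have "sym_diff U X \<in> lebesgue_null"
    using null_sets.Un [OF *(3,4)] by (rule null_sets_completion_subset)
  then show "X \<in> {X. \<exists>U\<in>\<T>. sym_diff U X \<in> lebesgue_null}"
    using *(2) by blast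
next
  fix X
  assume "X \<in> {X. \<exists>U\<in>\<T>. sym_diff U X \<in> lebesgue_null}"
  then obtain U where U: "U \<in> \<T>" "sym_diff U X \<in> lebesgue_null"
    by blast
  have "U - X \<in> lebesgue_null" "X - U \<in> lebesgue_null"
    using U(2) by (auto intro: null_sets_completion_subset)
  moreover have "X = (U - (U - X)) \<union> (X - U)"
    by blast
  ultimately show "X \<in> \<T> *\<^sub>F lebesgue_null"
    using U(1) unfolding fam_star_def by blast
qed

lemma null_fam_star_subset: "lebesgue_null *\<^sub>F \<T> \<subseteq> \<T> *\<^sub>F lebesgue_null"
proof
  fix X
  assume "X \<in> lebesgue_null *\<^sub>F \<T>"
  then obtain N U where *: "X = N \<union> U" "N \<in> lebesgue_null" "U \<in> \<T>"
    unfolding null_fam_star_eq by blast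
  moreover have "sym_diff U X \<subseteq> N"
    using *(1) by blast
  ultimately show "X \<in> \<T> *\<^sub>F lebesgue_null"
    unfolding fam_star_null_eq by (blast intro: null_sets_completion_subset)
qed

lemma subset_null_fam_star: "\<T> \<subseteq> lebesgue_null *\<^sub>F \<T>"
proof
  fix U
  assume "U \<in> \<T>"
  moreover have "U = {} \<union> U" "{} \<in> lebesgue_null"
    by auto
  ultimately show "U \<in> lebesgue_null *\<^sub>F \<T>"
    unfolding null_fam_star_eq by blast
qed

lemma semigroup_null_fam_star:
  assumes "semigroup_of_sets \<T>"
  shows "semigroup_of_sets (lebesgue_null *\<^sub>F \<T>)"
proof (rule semigroup_of_setsI)
  show "lebesgue_null *\<^sub>F \<T> \<noteq> {}"
    using assms subset_null_fam_star unfolding semigroup_of_sets_def by blast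
next
  fix X Y
  assume "X \<in> lebesgue_null *\<^sub>F \<T>" "Y \<in> lebesgue_null *\<^sub>F \<T>"
  then obtain M U N W where *: "X = M \<union> U" "M \<in> lebesgue_null" "U \<in> \<T>"
    "Y = N \<union> W" "N \<in> lebesgue_null" "W \<in> \<T>"
    unfolding null_fam_star_eq by blast
  have "X \<union> Y = (M \<union> N) \<union> (U \<union> W)"
    using *(1,4) by blast
  moreover have "M \<union> N \<in> lebesgue_null"
    using *(2,5) by (rule null_sets.Un)
  moreover have "U \<union> W \<in> \<T>"
    using assms *(3,6) by (rule semigroup_of_sets_Un)
  ultimately show "X \<union> Y \<in> lebesgue_null *\<^sub>F \<T>"
    unfolding null_fam_star_eq by blast
qed

text \<open>Agreement up to null sets is compatible with unions, because the symmetric difference of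
  two unions lies in the union of the symmetric differences.\<close>

lemma semigroup_fam_star_null:
  assumes "semigroup_of_sets \<T>"
  shows "semigroup_of_sets (\<T> *\<^sub>F lebesgue_null)"
proof (rule semigroup_of_setsI)
  show "\<T> *\<^sub>F lebesgue_null \<noteq> {}"
    using assms subset_null_fam_star [of \<T>] null_fam_star_subset [of \<T>]
    unfolding semigroup_of_sets_def by blast
next
  fix X Y
  assume "X \<in> \<T> *\<^sub>F lebesgue_null" "Y \<in> \<T> *\<^sub>F lebesgue_null"
  then obtain U W where *: "U \<in> \<T>" "sym_diff U X \<in> lebesgue_null"
    "W \<in> \<T>" "sym_diff W Y \<in> lebesgue_null"
    unfolding fam_star_null_eq by blast
  have "sym_diff (U \<union> W) (X \<union> Y) \<subseteq> sym_diff U X \<union> sym_diff W Y"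
    by blast
  then have "sym_diff (U \<union> W) (X \<union> Y) \<in> lebesgue_null"
    using null_sets.Un [OF *(2,4)] by (rule null_sets_completion_subset)
  then show "X \<union> Y \<in> \<T> *\<^sub>F lebesgue_null"
    using semigroup_of_sets_Un [OF assms *(1,3)] unfolding fam_star_null_eq by blast
qed

section \<open>Non-measurability\<close>

text \<open>By inner regularity \<open>S\<close> exceeds a closed subset by arbitrarily little
  measure, and that closed subset, being countable, is null.\<close>

lemma lebesgue_null_if_closed_subsets_countable:
  fixes S :: "real set"
  assumes "S \<in> sets lebesgue" "\<And>F. closed F \<Longrightarrow> F \<subseteq> S \<Longrightarrow> countable F"
  shows "S \<in> null_sets lebesgue"
proof -
  have "emeasure lebesgue S \<le> ennreal e" if e: "e > 0" for e
  proof -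
    obtain F where F: "closed F" "F \<subseteq> S" "S - F \<in> lmeasurable"
      "emeasure lebesgue (S - F) < ennreal e"
      using sets_lebesgue_inner_closed [OF assms(1) e] by blast
    have "F \<in> null_sets lebesgue"
      using assms(2) [OF F(1,2)] countable_imp_null_set_lborel null_sets_completionI by blast
    then have "emeasure lebesgue ((S - F) \<union> F) = emeasure lebesgue (S - F)"
      using F(3) by (intro emeasure_Un_null_set) auto
    moreover have "(S - F) \<union> F = S"
      using F(2) by blast
    ultimately show ?thesis
      using F(4) by simp
  qed
  then have "emeasure lebesgue S \<le> 0 + ennreal e" if "e > 0" for e
    using that by simp
  then have "emeasure lebesgue S \<le> 0"
    by (rule ennreal_le_epsilon)
  then have "emeasure lebesgue S = 0"
    by simp
  then show ?thesis
    using assms(1) by (rule null_setsI)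
qed

text \<open>Instead of moving \<open>B\<close>, the closed set is shifted back by \<open>x\<close>,
  which keeps it closed and uncountable.\<close>

lemma bernstein_translate_meets_closed:
  assumes "bernstein_set B" "closed F" "uncountable F"
  shows "(\<lambda>h. h + x) ` B \<inter> F \<noteq> {}"
proof -
  have "closed ((\<lambda>a. - x + a) ` F)"
    using assms(2) by (rule closed_translation)
  moreover have "uncountable ((\<lambda>a. - x + a) ` F)"
    using assms(3) by (simp add: countable_image_inj_eq)
  ultimately have "B \<inter> (\<lambda>a. - x + a) ` F \<noteq> {}"
    using assms(1) unfolding bernstein_set_def by blast
  then obtain a where "a \<in> F" "- x + a \<in> B"
    by blast
  then have "a \<in> (\<lambda>h. h + x) ` B"
    by (simp add: mem_add_coset_iff)
  then show ?thesis
    using \<open>a \<in> F\<close> by blast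
qed

text \<open>The coset makes the complement of \<open>U\<close> too thin to contain an uncountable
  closed set, while sparseness of \<open>U\<close> keeps that complement from being null.
  Measurability would make these two facts incompatible.\<close>

lemma not_lebesgue_if_sparse_superset_of_coset:
  assumes "bernstein_set B" "C \<in> add_cosets B" "C \<subseteq> U" "translation_sparse U"
  shows "U \<notin> sets lebesgue"
proof
  assume "U \<in> sets lebesgue"
  then have "- U \<in> sets lebesgue"
    by (simp add: Compl_in_sets_lebesgue)
  moreover obtain x where "C = (\<lambda>h. h + x) ` B"
    using assms(2) unfolding add_cosets_def by blast
  then have "countable F" if "closed F" "F \<subseteq> - U" for F
    using bernstein_translate_meets_closed [OF assms(1) that(1), of x] that(2) assms(3) by blast
  ultimately have "- U \<in> null_sets lebesgue"
    by (rule lebesgue_null_if_closed_subsets_countable)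
  then show False
    using translation_sparse_compl_not_null [OF assms(4)] by contradiction
qed

text \<open>The line itself is an uncountable closed set. Properness is what gives cosets of a
  Bernstein subgroup their sparseness.\<close>

lemma bernstein_neq_UNIV:
  assumes "bernstein_set B"
  shows "B \<noteq> UNIV"
proof -
  have "(UNIV - B) \<inter> UNIV \<noteq> {}"
    using assms closed_UNIV uncountable_UNIV_real unfolding bernstein_set_def by metis
  then show ?thesis by blast
qed

theorem theorem5p8:
  fixes B1 B2 :: "real set" and \<T> :: "real set set"
  assumes "bernstein_set B1" and "add_subgroup B1"
    and "bernstein_set B2" and "add_subgroup B2"
    and "\<T> = fin_unions (add_cosets B1) \<or>\<^sub>F fin_unions (add_cosets B2) \<or>\<^sub>F fin_unions vitali_selectors"
  shows "semigroup_of_sets (lebesgue_null *\<^sub>F \<T>) \<and> semigroup_of_sets (\<T> *\<^sub>F lebesgue_null)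
    \<and> \<T> \<subseteq> lebesgue_null *\<^sub>F \<T> \<and> lebesgue_null *\<^sub>F \<T> \<subseteq> \<T> *\<^sub>F lebesgue_null
    \<and> translation_invariant (lebesgue_null *\<^sub>F \<T>) \<and> translation_invariant (\<T> *\<^sub>F lebesgue_null)
    \<and> (\<forall>A \<in> lebesgue_null *\<^sub>F \<T>. A \<notin> sets lebesgue) \<and> (\<forall>A \<in> \<T> *\<^sub>F lebesgue_null. A \<notin> sets lebesgue)"
proof -
  have cosets: "add_cosets H \<noteq> {}" "translation_invariant (add_cosets H)" for H
    using add_cosets_translate unfolding translation_invariant_def
    by (auto simp: add_cosets_def)
  have semigroup: "semigroup_of_sets \<T>"
    unfolding assms(5)
    by (intro semigroup_fam_join semigroup_fin_unions cosets vitali_selectors_nonempty)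
  have "translation_invariant vitali_selectors"
    using vitali_selectors_translate unfolding translation_invariant_def by blast
  then have invariant: "translation_invariant \<T>"
    unfolding assms(5)
    by (intro translation_invariant_fam_join translation_invariant_fin_unions cosets)
  have nonmeasurable: "U \<notin> sets lebesgue" if U_in: "U \<in> \<T>" for U
  proof -
    obtain E1 E2 W where U: "U = E1 \<union> E2 \<union> W" and E: "E1 \<in> fin_unions (add_cosets B1)"
      "E2 \<in> fin_unions (add_cosets B2)" "W \<in> fin_unions vitali_selectors"
      using U_in unfolding assms(5) fam_join_def by blast
    have "translation_sparse E1" "translation_sparse E2" "translation_sparse W"
      using E assms(1-4) bernstein_neq_UNIV translation_sparse_add_coset translation_sparse_vitali_selector
      by (blast intro: translation_sparse_fin_unions)+
    then have "translation_sparse U"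
      unfolding U by (intro translation_sparse_Un)
    \<comment> \<open>Finite unions have at least one term, so \<open>E1\<close> contains a full
      coset of \<open>B1\<close>.\<close>
    moreover obtain C where "C \<in> add_cosets B1" "C \<subseteq> E1"
      using E(1) unfolding fin_unions_eq by blast
    moreover from this have "C \<subseteq> U"
      unfolding U by blast
    ultimately show ?thesis
      using not_lebesgue_if_sparse_superset_of_coset [OF assms(1)] by blast
  qed
  \<comment> \<open>This settles both families, since \<open>lebesgue_null *\<^sub>F \<T>\<close> is
    contained in \<open>\<T> *\<^sub>F lebesgue_null\<close>.\<close>
  have star: "A \<notin> sets lebesgue" if A_in: "A \<in> \<T> *\<^sub>F lebesgue_null" for A
  proof
    assume A: "A \<in> sets lebesgue"
    obtain U where U: "U \<in> \<T>" "sym_diff U A \<in> lebesgue_null"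
      using A_in unfolding fam_star_null_eq by blast
    \<comment> \<open>By completeness both differences are measurable, so \<open>U\<close> can be
      recovered from a measurable \<open>A\<close>.\<close>
    have "U - A \<in> sets lebesgue" "A - U \<in> sets lebesgue"
      by (rule null_setsD2, rule null_sets_completion_subset [OF _ U(2)], blast)+
    moreover have "U = (A - (A - U)) \<union> (U - A)"
      by blast
    ultimately have "U \<in> sets lebesgue"
      using A by (metis sets.Diff sets.Un)
    then show False
      using nonmeasurable [OF U(1)] by contradiction
  qed
  show ?thesis
    using semigroup invariant star null_fam_star_subset [of \<T>] subset_null_fam_star [of \<T>]
      semigroup_null_fam_star semigroup_fam_star_null
      translation_invariant_fam_star translation_invariant_null_sets
    by blast
qed

end
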